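(* Let $\alpha\in\mathbb{N}$, $k\in\mathbb{N}$ with $k\le\alpha$, and let $\beta=(\beta_0,\dots,\beta_{k-1})$ be generic (defined in the context). Then $\mathcal{A}=\bar{\mathcal{A}}$ and $\mathcal{D}=\bar{\mathcal{D}}$, where these sets are as defined in the context.
   Context: Laguerre polynomials: for $n\in\mathbb{N}_0$, $L^\alpha_n(x)=\frac{\Gamma(\alpha+n+1)}{\Gamma(\alpha+1)\Gamma(n+1)}\,{}_1F_1(-n;\alpha+1;x)$, where ${}_1F_1(a;c;x)=\sum_{j\ge0}\frac{(a)_jx^j}{(c)_jj!}$; by convention $L^\alpha_{-j}(x)=0$ for $j\in\mathbb{N}$. For $j\in\{0,\dots,k-1\}$ define the polynomials in $n$ $\phi^{1,j}_n=\frac{(-1)^j}{(1-\alpha)_j}\binom{n+j}{j}$, $\phi^{2,j}_n=\frac{(-1)^j}{j!}\binom{n+\alpha+j}{\alpha+j}$, and $\psi^{(j)}_n=\sum_{l=0}^{j}\beta_{j-l}\phi^{1,l}_n+\phi^{2,j}_n$. The discrete Wronskian is $\mathrm{Wr}_n(g^{(1)}_n,\dots,g^{(m)}_n)=\det\big(g^{(i)}_{n-j+1}\big)_{1\le i,j\le m}$. Set $\tau(n)=\mathrm{Wr}_n(\psi^{(0)}_n,\dots,\psi^{(k-1)}_n)$ (a polynomial in $n$), and $\hat L^{\alpha;\beta}_n(x)=\mathrm{Wr}_n(\psi^{(0)}_n,\dots,\psi^{(k-1)}_n,L^\alpha_n(x))$ for $n\in\mathbb{N}_0$ (with $L^\alpha_m=0$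 for $m<0$). The value $\hat L^{\alpha;\beta}_n(0)$, i.e. $\mathrm{Wr}_n(\psi^{(0)}_n,\dots,\psi^{(k-1)}_n,\binom{n+\alpha}{\alpha})$, is a polynomial in $n$. $\beta$ is admissible if $\tau(n)\ne0$ for $n=-1,0,1,\dots$, and generic if it is admissible and the resultant $\mathcal{R}(\tau(n),\hat L^{\alpha;\beta}_n(0))$ of these two polynomials in $n$ is nonzero. Let $\mathfrak{D}$ be the algebra of differential operators generated by $\frac{d}{dx}$ and $x\frac{d^2}{dx^2}-x\frac{d}{dx}$. Let $\mathcal{A}=\{h\in\mathbb{C}[n]:\frac{h(n)-h(n-1)}{\tau(n-1)}\in\mathbb{C}[n]\}$ and $\mathcal{D}$ the set of operators $\hat B\in\mathfrak{D}$ for which there is $h\in\mathcal{A}$ with $\hat B\hat L^{\alpha;\beta}_n(x)=h(n)\hat L^{\alpha;\beta}_n(x)$ for all $n\in\mathbb{N}_0$. Let $\bar{\mathcal{A}}$ be the set of all functions $h:\mathbb{N}_0\to\mathbb{C}$ for which there exists a differential operator $\hat B_h=\sum_{j=0}^{m}b_j(x)\frac{d^j}{dx^j}$ with $\hat B_h\hat L^{\alpha;\beta}_n(x)=h(n)\hat L^{\alpha;\beta}_n(x)$ for all $n\in\mathbb{N}_0$ (such $h$ are automatically polynomials in $n$, so $\bar{\mathcal A}$ is regarded as a subset of $\mathbb{C}[n]$), and $\bar{\mathcal{D}}=\{\hat B_h:h\in\bar{\mathcal{A}}\}$. *)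

theory Defs
  imports "HOL-Computational_Algebra.Polynomial" "Subresultants.Resultant_Prelim"
begin

definition binpoly :: "nat \<Rightarrow> complex poly" where
  "binpoly a = smult (1 / of_nat (fact a)) (\<Prod>i\<in>{1..a}. [:of_nat i, 1:])"

definition phi1 :: "nat \<Rightarrow> nat \<Rightarrow> complex poly" where
  "phi1 \<alpha> j = smult ((-1)^j / pochhammer (1 - of_nat \<alpha>) j) (binpoly j)"

definition phi2 :: "nat \<Rightarrow> nat \<Rightarrow> complex poly" where
  "phi2 \<alpha> j = smult ((-1)^j / of_nat (fact j)) (binpoly (\<alpha> + j))"

definition psi :: "nat \<Rightarrow> (nat \<Rightarrow> complex) \<Rightarrow> nat \<Rightarrow> complex poly" where
  "psi \<alpha> \<beta> j = (\<Sum>l\<le>j. smult (\<beta> (j - l)) (phi1 \<alpha> l)) + phi2 \<alpha> j"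

definition shiftp :: "complex poly \<Rightarrow> nat \<Rightarrow> complex poly" where
  "shiftp p j = pcompose p [:- of_nat j, 1:]"

text \<open>Discrete Wronskian of polynomials in n: det (g_i (n - j)), 0 \<le> i,j < m
  (0-indexed version of det (g^(i)_{n-j+1}), 1 \<le> i,j \<le> m).\<close>
definition wr_poly :: "(nat \<Rightarrow> complex poly) \<Rightarrow> nat \<Rightarrow> complex poly" where
  "wr_poly g m = det (mat m m (\<lambda>(i, j). shiftp (g i) j))"

definition tau :: "nat \<Rightarrow> nat \<Rightarrow> (nat \<Rightarrow> complex) \<Rightarrow> complex poly" where
  "tau \<alpha> k \<beta> = wr_poly (psi \<alpha> \<beta>) k"

text \<open>hat L_n(0) as a polynomial in n: Wr(psi^0,...,psi^{k-1}, binom(n+\<alpha>,\<alpha>)).\<close>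
definition Lhat0 :: "nat \<Rightarrow> nat \<Rightarrow> (nat \<Rightarrow> complex) \<Rightarrow> complex poly" where
  "Lhat0 \<alpha> k \<beta> = wr_poly (\<lambda>i. if i < k then psi \<alpha> \<beta> i else binpoly \<alpha>) (Suc k)"

definition laguerre :: "nat \<Rightarrow> nat \<Rightarrow> complex poly" where
  "laguerre \<alpha> n = smult (of_nat (fact (\<alpha> + n)) / (of_nat (fact \<alpha>) * of_nat (fact n)))
     (\<Sum>j\<le>n. monom (pochhammer (- of_nat n) j / (pochhammer (of_nat \<alpha> + 1) j * of_nat (fact j))) j)"

definition laguerre_int :: "nat \<Rightarrow> int \<Rightarrow> complex poly" where
  "laguerre_int \<alpha> m = (if m < 0 then 0 else laguerre \<alpha> (nat m))"

text \<open>hat L_n(x) = Wr_n(psi^0_n,...,psi^{k-1}_n, L^\<alpha>_n(x)) as a polynomial in x;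
  entry (i,j) (0-indexed) is g^(i) evaluated at n - j.\<close>
definition Lhat :: "nat \<Rightarrow> nat \<Rightarrow> (nat \<Rightarrow> complex) \<Rightarrow> nat \<Rightarrow> complex poly" where
  "Lhat \<alpha> k \<beta> n = det (mat (Suc k) (Suc k) (\<lambda>(i, j).
      if i < k then [: poly (psi \<alpha> \<beta> i) (of_int (int n - int j)) :]
      else laguerre_int \<alpha> (int n - int j)))"

definition admissible :: "nat \<Rightarrow> nat \<Rightarrow> (nat \<Rightarrow> complex) \<Rightarrow> bool" where
  "admissible \<alpha> k \<beta> \<longleftrightarrow> (\<forall>n::int. n \<ge> -1 \<longrightarrow> poly (tau \<alpha> k \<beta>) (of_int n) \<noteq> 0)"

definition generic :: "nat \<Rightarrow> nat \<Rightarrow> (nat \<Rightarrow> complex) \<Rightarrow> bool" where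
  "generic \<alpha> k \<beta> \<longleftrightarrow> admissible \<alpha> k \<beta> \<and> resultant (tau \<alpha> k \<beta>) (Lhat0 \<alpha> k \<beta>) \<noteq> 0"

text \<open>Differential operators are represented by their action on polynomials in x,
  with result a function of x. Such an operator is determined by this action.\<close>
type_synonym dop = "complex poly \<Rightarrow> complex \<Rightarrow> complex"

definition is_diffop :: "dop \<Rightarrow> bool" where
  "is_diffop B \<longleftrightarrow> (\<exists>m (b :: nat \<Rightarrow> complex \<Rightarrow> complex).
      B = (\<lambda>p x. \<Sum>j\<le>m. b j x * poly ((pderiv ^^ j) p) x))"

definition Eop :: "complex poly \<Rightarrow> complex poly" where
  "Eop p = [:0, 1:] * pderiv (pderiv p) - [:0, 1:] * pderiv p"

inductive_set Dalg :: "(complex poly \<Rightarrow> complex poly) set" where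
  scalar: "(\<lambda>p. smult c p) \<in> Dalg"
| deriv: "pderiv \<in> Dalg"
| E: "Eop \<in> Dalg"
| add: "S \<in> Dalg \<Longrightarrow> T \<in> Dalg \<Longrightarrow> (\<lambda>p. S p + T p) \<in> Dalg"
| comp: "S \<in> Dalg \<Longrightarrow> T \<in> Dalg \<Longrightarrow> (\<lambda>p. S (T p)) \<in> Dalg"

definition Dalg_ops :: "dop set" where
  "Dalg_ops = {(\<lambda>p. poly (T p)) | T. T \<in> Dalg}"

definition eigen :: "nat \<Rightarrow> nat \<Rightarrow> (nat \<Rightarrow> complex) \<Rightarrow> dop \<Rightarrow> complex poly \<Rightarrow> bool" where
  "eigen \<alpha> k \<beta> B h \<longleftrightarrow> (\<forall>n::nat. B (Lhat \<alpha> k \<beta> n) = (\<lambda>x. poly h (of_nat n) * poly (Lhat \<alpha> k \<beta> n) x))"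

definition Aset :: "nat \<Rightarrow> nat \<Rightarrow> (nat \<Rightarrow> complex) \<Rightarrow> complex poly set" where
  "Aset \<alpha> k \<beta> = {h. shiftp (tau \<alpha> k \<beta>) 1 dvd (h - shiftp h 1)}"

definition Dset :: "nat \<Rightarrow> nat \<Rightarrow> (nat \<Rightarrow> complex) \<Rightarrow> dop set" where
  "Dset \<alpha> k \<beta> = {B \<in> Dalg_ops. \<exists>h \<in> Aset \<alpha> k \<beta>. eigen \<alpha> k \<beta> B h}"

definition Abar :: "nat \<Rightarrow> nat \<Rightarrow> (nat \<Rightarrow> complex) \<Rightarrow> complex poly set" where
  "Abar \<alpha> k \<beta> = {h. \<exists>B. is_diffop B \<and> eigen \<alpha> k \<beta> B h}"

definition Dbar :: "nat \<Rightarrow> nat \<Rightarrow> (nat \<Rightarrow> complex) \<Rightarrow> dop set" where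
  "Dbar \<alpha> k \<beta> = {B. is_diffop B \<and> (\<exists>h \<in> Abar \<alpha> k \<beta>. eigen \<alpha> k \<beta> B h)}"

end

theory Submission
  imports Defs "Subresultants.Subresultant_Gcd" "HOL-Computational_Algebra.Field_as_Ring"
    "HOL-Computational_Algebra.Fundamental_Theorem_Algebra"
begin

text \<open>
  Expanding along the last row, \<open>Lhat n = \<Sum>i\<le>k. C\<^sub>i(n) L\<^sub>n\<^sub>-\<^sub>i\<close> with polynomial cofactors, \<open>C\<^sub>0(n) = \<plusminus>\<tau>(n - 1)\<close>
  and \<open>C\<^sub>k(n) = \<tau>(n)\<close>; by admissibility \<open>Lhat n\<close> has degree \<open>n\<close>, so an operator is determined by its
  eigenvalues.

  If \<open>\<tau>(n - 1)\<close> divides \<open>h(n) - h(n - 1)\<close>, put \<open>s(n) = (h(n + 1) - h(n)) / \<tau>(n)\<close> and choose weights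
  \<open>w\<^sub>j\<close> from \<open>s\<close> and the cofactors of \<open>\<tau>\<close> so that replacing \<open>L\<^sub>n\<close> by
  \<open>h(n + k) L\<^sub>n - (\<Sum>j. \<psi>\<^sub>j(n) (\<Sum>m\<le>n. w\<^sub>j(m) L\<^sub>m))\<close> multiplies the Wronskian by \<open>h(n)\<close> (a summation by
  parts). This replacement is the action of a differential operator of the algebra, since \<open>n\<close> is
  an eigenvalue of such an operator and \<open>\<Sum>m\<le>n. L\<^sub>m = L\<^sub>n - L\<^sub>n'\<close>.

  Conversely let \<open>B\<close> have eigenvalues \<open>h(n)\<close>. For functions \<open>f, f'\<close> of \<open>n\<close>, the polynomial \<open>\<tau>(n - 1)\<close> divides
  \<open>Wr(\<psi>, f)(n) Wr(\<psi>, f')(n - 1) - Wr(\<psi>, f')(n) Wr(\<psi>, f)(n - 1)\<close>. Taking for \<open>f\<close> the value and for \<open>f'\<close> the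
  derivatives of \<open>L\<^sub>n\<close> at \<open>0\<close>, the eigenvalue equation at \<open>x = 0\<close> shows that \<open>\<tau>(n - 1)\<close> divides
  \<open>a(n) a(n - 1) (h(n - 1) - h(n))\<close> with \<open>a(n) = Lhat n (0)\<close>. Genericity makes \<open>\<tau>(n - 1)\<close> coprime to
  \<open>a(n - 1)\<close>, and also to \<open>a(n)\<close>: at a common root \<open>z\<close> the analogous divisibility with cofactors
  instead of \<open>Wr(\<psi>, f')\<close> would give \<open>\<tau>(z) a(z - 1) = 0\<close>, hence \<open>\<tau>(z) = a(z) = 0\<close>.
\<close>

section \<open>Complex polynomials and determinants\<close>

lemma resultant_nonzero_no_common_root:
  fixes p q :: "complex poly"
  assumes "resultant p q \<noteq> 0" and "p \<noteq> 0" and "poly p z = 0"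
  shows "poly q z \<noteq> 0"
proof
  assume q: "poly q z = 0"
  have "[:-z, 1:] dvd gcd p q"
    using assms(3) q by (simp add: poly_eq_0_iff_dvd)
  moreover have "gcd p q \<noteq> 0"
    using assms(2) by auto
  ultimately have "degree [:-z, 1:] \<le> degree (gcd p q)"
    by (rule dvd_imp_degree_le)
  then show False
    using assms(1) resultant_0_gcd[of p q] by auto
qed

lemma coprime_if_no_common_root:
  fixes p q :: "complex poly"
  assumes "p \<noteq> 0" and "\<And>z. poly p z = 0 \<Longrightarrow> poly q z \<noteq> 0"
  shows "coprime p q"
proof (rule coprimeI)
  fix c assume c: "c dvd p" "c dvd q"
  with assms(1) have "c \<noteq> 0" by auto
  have "degree c = 0"
  proof (rule ccontr)
    assume "degree c \<noteq> 0"
    then obtain z where "poly c z = 0"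
      using fundamental_theorem_of_algebra constant_degree by metis
    with c assms(2)[of z] show False by (metis dvd_trans poly_eq_0_iff_dvd)
  qed
  with \<open>c \<noteq> 0\<close> show "is_unit c" by (simp add: is_unit_iff_degree)
qed

text \<open>The threshold \<open>N\<close> allows an identity in \<open>n\<close> to be checked only
  where no Laguerre index \<open>n - i\<close> is negative.\<close>

lemma poly_eqI_of_nat:
  fixes p q :: "complex poly"
  assumes "\<And>n. n \<ge> N \<Longrightarrow> poly p (of_nat n) = poly q (of_nat n)"
  shows "p = q"
proof (rule ccontr)
  assume "p \<noteq> q"
  then have "finite {x. poly (p - q) x = 0}" by (intro poly_roots_finite) simp
  moreover have "of_nat ` {N..} \<subseteq> {x. poly (p - q) x = 0}" using assms by auto
  ultimately have "finite ((of_nat :: nat \<Rightarrow> complex) ` {N..})" by (rule finite_subset[rotated])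
  then have "finite {N..}" by (rule finite_imageD) simp
  then show False by (simp add: infinite_Ici)
qed

text \<open>The cofactors along the replaced column do not see that column. This makes the
  right-hand side of Cramer's rule linear in \<open>b\<close>.\<close>

lemma det_replace_col:
  assumes "A \<in> carrier_mat n n" and "k < n"
  shows "det (replace_col A b k) = (\<Sum>i<n. b $ i * cofactor A i k)"
proof -
  have R: "replace_col A b k \<in> carrier_mat n n" using assms by (auto simp: replace_col_def)
  have "cofactor (replace_col A b k) i k = cofactor A i k" if "i < n" for i
  proof -
    have "mat_delete (replace_col A b k) i k = mat_delete A i k"
      using assms that by (intro eq_matI) (auto simp: mat_delete_def replace_col_def)
    then show ?thesis by (simp add: cofactor_def)
  qed
  then show ?thesis
    unfolding laplace_expansion_column[OF R assms(2)]
    using assms by (intro sum.cong) (auto simp: replace_col_def)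
qed

lemma det_replace_col_smult:
  assumes "A \<in> carrier_mat n n" and "k < n" and "b \<in> carrier_vec n"
  shows "det (replace_col A (c \<cdot>\<^sub>v b) k) = c * det (replace_col A b k)"
  using assms by (simp add: det_replace_col sum_distrib_left mult.assoc)

text \<open>Modulo \<open>det A\<close> the solutions \<open>v\<close>, \<open>v'\<close> are both multiples of the (rank one) adjugate,
  so their two by two minors vanish. The proof applies Cramer's rule to \<open>A\<close> with column \<open>b\<close>
  replaced by \<open>q\<close>, whose determinant is \<open>v' $ b\<close>.\<close>
lemma det_dvd_minor_of_solutions:
  fixes A :: "'a :: idom mat"
  assumes A: "A \<in> carrier_mat n n" and det: "det A \<noteq> 0"
    and v: "v \<in> carrier_vec n" "A *\<^sub>v v = det A \<cdot>\<^sub>v p" and p: "p \<in> carrier_vec n"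
    and v': "v' \<in> carrier_vec n" "A *\<^sub>v v' = det A \<cdot>\<^sub>v q" and q: "q \<in> carrier_vec n"
    and ab: "a < n" "b < n"
  shows "det A dvd v $ a * v' $ b - v $ b * v' $ a"
proof -
  have main: "det A dvd v' $ b * v $ a - v $ b * v' $ a"
    if v: "v \<in> carrier_vec n" "A *\<^sub>v v = det A \<cdot>\<^sub>v p" and p: "p \<in> carrier_vec n"
      and v': "v' \<in> carrier_vec n" "A *\<^sub>v v' = det A \<cdot>\<^sub>v q" and q: "q \<in> carrier_vec n"
      and ab: "a < n" "b < n" "a \<noteq> b" and nz: "v' $ b \<noteq> 0" for v v' p q a b
  proof -
    define A' where "A' = replace_col A q b"
    \<comment> \<open>The vector \<open>v'_b v - v_b v'\<close> vanishes at \<open>b\<close>, so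
      replacing column \<open>b\<close> does not affect its image
      \<open>det A (v'_b p - v_b q)\<close>. The entry \<open>det A * v_b\<close> put at
      \<open>b\<close> meets the new column \<open>q\<close> and cancels the \<open>q\<close>
      term.\<close>
    define x where "x = vec n (\<lambda>i. if i = b then det A * v $ b else v' $ b * v $ i - v $ b * v' $ i)"
    have A': "A' \<in> carrier_mat n n" using A by (auto simp: A'_def replace_col_def)
    have x: "x \<in> carrier_vec n" by (simp add: x_def)
    have row: "(\<Sum>c<n. A $$ (i, c) * u $ c) = d * r $ i"
      if "A *\<^sub>v u = d \<cdot>\<^sub>v r" "u \<in> carrier_vec n" "r \<in> carrier_vec n" "i < n" for u r d i
    proof -
      have "(A *\<^sub>v u) $ i = (\<Sum>c<n. A $$ (i, c) * u $ c)"
        using A that(2,4) by (auto simp: scalar_prod_def lessThan_atLeast0 intro!: sum.cong)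
      then show ?thesis using that by simp
    qed
    have "A' *\<^sub>v x = (det A * v' $ b) \<cdot>\<^sub>v p"
    proof (rule eq_vecI)
      fix i assume "i < dim_vec ((det A * v' $ b) \<cdot>\<^sub>v p)"
      then have i: "i < n" using p by simp
      have "(A' *\<^sub>v x) $ i = (\<Sum>c<n. A' $$ (i, c) * x $ c)"
        using A' x i by (auto simp: scalar_prod_def lessThan_atLeast0 intro!: sum.cong)
      also have "\<dots> = (\<Sum>c<n. A $$ (i, c) * (v' $ b * v $ c - v $ b * v' $ c)
                        + (if c = b then q $ i * (det A * v $ b) else 0))"
        using A i by (intro sum.cong refl) (auto simp: A'_def replace_col_def x_def)
      also have "\<dots> = v' $ b * (\<Sum>c<n. A $$ (i, c) * v $ c) - v $ b * (\<Sum>c<n. A $$ (i, c) * v' $ c)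
                        + q $ i * (det A * v $ b)"
        using ab(2) by (simp add: sum.distrib sum_subtractf sum_distrib_left algebra_simps)
      also have "\<dots> = det A * v' $ b * p $ i"
        unfolding row[OF v(2,1) p i] row[OF v'(2,1) q i] by (simp add: algebra_simps)
      finally show "(A' *\<^sub>v x) $ i = ((det A * v' $ b) \<cdot>\<^sub>v p) $ i" using i p by simp
    qed (use A' p in auto)
    then have "det A * v' $ b * det (replace_col A' p a) = x $ a * det A'"
      using cramer_lemma_mat[OF A' x ab(1)] det_replace_col_smult[OF A' ab(1) p] by metis
    moreover have "det A * det A' = det A * v' $ b"
      using cramer_lemma_mat[OF A v'(1) ab(2)] det_replace_col_smult[OF A ab(2) q]
      by (metis A'_def mult.commute v'(2))
    ultimately have "det A * det (replace_col A' p a) * v' $ b = x $ a * v' $ b"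
      using det by (simp add: mult_ac)
    then have "x $ a = det A * det (replace_col A' p a)" using nz by simp
    then have "det A dvd x $ a" by simp
    then show ?thesis using ab by (simp add: x_def)
  qed
  \<comment> \<open>The minor is antisymmetric in \<open>a\<close> and \<open>b\<close>, so it
    suffices that one of the two entries of \<open>v'\<close> is nonzero; if both vanish, so does
    the minor.\<close>
  consider "a = b" | "a \<noteq> b" "v' $ b \<noteq> 0" | "a \<noteq> b" "v' $ a \<noteq> 0" | "v' $ a = 0" "v' $ b = 0"
    by blast
  then show ?thesis
  proof cases
    case 2
    from main[OF v p v' q ab this] show ?thesis by (simp add: mult.commute)
  next
    case 3
    from main[OF v p v' q ab(2,1) _ 3(2)] 3(1)
    have "det A dvd - (v $ a * v' $ b - v $ b * v' $ a)" by (simp add: mult.commute)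
    then show ?thesis by (simp only: dvd_minus_iff)
  qed simp_all
qed

section \<open>Discrete Wronskians\<close>

lemma poly_shiftp: "poly (shiftp p j) x = poly p (x - of_nat j)"
  by (simp add: shiftp_def poly_pcompose)

lemma shiftp_shiftp: "shiftp (shiftp p i) j = shiftp p (i + j)"
  by (rule poly_eqI_of_nat[of 0]) (simp add: poly_shiftp algebra_simps)

lemma shiftp_0 [simp]: "shiftp p 0 = p"
  by (rule poly_eqI_of_nat[of 0]) (simp add: poly_shiftp)

lemma shiftp_mult: "shiftp (p * q) j = shiftp p j * shiftp q j"
  by (simp add: shiftp_def pcompose_mult)

lemma shiftp_add: "shiftp (p + q) j = shiftp p j + shiftp q j"
  by (simp add: shiftp_def pcompose_add)

lemma shiftp_smult: "shiftp (smult c p) j = smult c (shiftp p j)"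
  by (simp add: shiftp_def pcompose_smult)

lemma shiftp_sum: "shiftp (\<Sum>i\<in>I. f i) j = (\<Sum>i\<in>I. shiftp (f i) j)"
  by (simp add: shiftp_def pcompose_sum)

lemma shiftp_eq_0_iff: "shiftp p j = 0 \<longleftrightarrow> p = 0"
  using pcompose_eq_0[of p "[:- of_nat j, 1:]"] by (auto simp: shiftp_def)

lemma comm_ring_hom_shiftp: "comm_ring_hom (\<lambda>p. shiftp p j)"
  by unfold_locales (simp_all add: shiftp_add shiftp_mult, simp_all add: shiftp_def pcompose_1)

lemma comm_ring_hom_poly_const: "comm_ring_hom (\<lambda>p :: complex poly. [: poly p x :])"
  by unfold_locales simp_all

text \<open>The last row is filled with zeros because its own cofactors do not depend on it; the
  same cofactors serve every appended function.\<close>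

definition wr_cofactor :: "(nat \<Rightarrow> complex poly) \<Rightarrow> nat \<Rightarrow> nat \<Rightarrow> complex poly" where
  "wr_cofactor g k i =
     cofactor (mat (Suc k) (Suc k) (\<lambda>(r, j). if r < k then shiftp (g r) j else 0)) k i"

text \<open>Stated for an arbitrary last row, so that it applies to matrices over polynomials in
  \<open>n\<close> and to those over polynomials in \<open>x\<close>.\<close>

lemma cofactor_last_row:
  assumes "A \<in> carrier_mat (Suc k) (Suc k)" "i \<le> k"
    and "\<And>r j. r < k \<Longrightarrow> j \<le> k \<Longrightarrow> A $$ (r, j) = f r j"
  shows "cofactor A k i = (-1) ^ (k + i) * det (mat k k (\<lambda>(r, j). f r (insert_index i j)))"
proof -
  have "mat_delete A k i = mat k k (\<lambda>(r, j). f r (insert_index i j))"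
    using assms by (intro eq_matI) (auto simp: mat_delete_def insert_index_def)
  then show ?thesis by (simp add: cofactor_def)
qed

lemma wr_cofactor_eq:
  assumes "i \<le> k"
  shows "wr_cofactor g k i = (-1) ^ (k + i) * det (mat k k (\<lambda>(r, j). shiftp (g r) (insert_index i j)))"
  unfolding wr_cofactor_def by (rule cofactor_last_row) (use assms in auto)

lemma wr_poly_expand:
  "wr_poly (\<lambda>i. if i < k then g i else f) (Suc k) = (\<Sum>i\<le>k. shiftp f i * wr_cofactor g k i)"
proof -
  let ?A = "mat (Suc k) (Suc k) (\<lambda>(i, j). shiftp (if i < k then g i else f) j)"
  have "cofactor ?A k i = wr_cofactor g k i" if "i \<le> k" for i
    unfolding wr_cofactor_eq[OF that] by (rule cofactor_last_row) (use that in auto)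
  moreover have "det ?A = (\<Sum>i<Suc k. ?A $$ (k, i) * cofactor ?A k i)"
    by (rule laplace_expansion_row) auto
  ultimately show ?thesis unfolding wr_poly_def lessThan_Suc_atMost by simp
qed

text \<open>Appending some \<open>g j\<close> that already occurs gives a determinant with two equal
  rows.\<close>

lemma wr_cofactor_orthogonal:
  assumes "j < k"
  shows "(\<Sum>i\<le>k. shiftp (g j) i * wr_cofactor g k i) = 0"
proof -
  let ?A = "mat (Suc k) (Suc k) (\<lambda>(r, i). shiftp (if r < k then g r else g j) i)"
  have "det ?A = 0"
    by (rule det_identical_rows[of _ "Suc k" j k]) (use assms in \<open>auto simp: vec_eq_iff\<close>)
  then show ?thesis by (simp only: wr_poly_expand[of k g "g j", symmetric] wr_poly_def)
qed

text \<open>Deleting the column of the point \<open>n\<close> leaves the points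
  \<open>n - 1, ..., n - k\<close>, which is the matrix of the Wronskian at
  \<open>n - 1\<close>.\<close>

lemma wr_cofactor_0: "wr_cofactor g k 0 = (-1) ^ k * shiftp (wr_poly g k) 1"
proof -
  have "map_mat (\<lambda>p. shiftp p 1) (mat k k (\<lambda>(r, j). shiftp (g r) j))
      = mat k k (\<lambda>(r, j). shiftp (g r) (insert_index 0 j))"
    by (intro eq_matI) (auto simp: shiftp_shiftp insert_index_def)
  then show ?thesis
    unfolding wr_cofactor_eq[OF le0] wr_poly_def
    by (metis comm_ring_hom.hom_det[OF comm_ring_hom_shiftp] add_0_right)
qed

lemma wr_cofactor_last: "wr_cofactor g k k = wr_poly g k"
proof -
  have "mat k k (\<lambda>(r, j). shiftp (g r) (insert_index k j)) = mat k k (\<lambda>(r, j). shiftp (g r) j)"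
    by (intro eq_matI) (auto simp: insert_index_def)
  then show ?thesis unfolding wr_cofactor_eq[OF order_refl] wr_poly_def by simp
qed

text \<open>These are the entries of \<open>adj_mat K * K\<close>, a multiple of the identity: the
  cofactors of column \<open>r\<close> annihilate all points \<open>n - i\<close> of the window
  except \<open>i = r\<close>.\<close>

lemma wr_poly_inverse:
  assumes "i < k" "r < k"
  shows "(\<Sum>j<k. shiftp (g j) i * cofactor (mat k k (\<lambda>(i, j). shiftp (g i) j)) j r)
           = (if i = r then wr_poly g k else 0)"
proof -
  define K where "K = mat k k (\<lambda>(i, j). shiftp (g i) j)"
  have K: "K \<in> carrier_mat k k" by (simp add: K_def)
  have "(adj_mat K * K) $$ (r, i) = (\<Sum>j<k. cofactor K j r * K $$ (j, i))"
    using assms K adj_mat(1)[OF K]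
    by (auto simp: scalar_prod_def lessThan_atLeast0 adj_mat_def intro!: sum.cong)
  also have "\<dots> = (\<Sum>j<k. shiftp (g j) i * cofactor K j r)"
    using assms by (intro sum.cong) (auto simp: K_def)
  finally show ?thesis
    unfolding adj_mat(3)[OF K] using assms by (auto simp: wr_poly_def K_def)
qed

section \<open>Laguerre polynomials and differential operators\<close>

text \<open>The binomial coefficient vanishes for \<open>j > n\<close>, so this form holds for all
  \<open>j\<close> and spares later case distinctions.\<close>

lemma coeff_laguerre:
  "coeff (laguerre \<alpha> n) j = (-1) ^ j * of_nat ((n + \<alpha>) choose (\<alpha> + j)) / of_nat (fact j)"
proof (cases "j \<le> n")
  case False
  then show ?thesis by (simp add: laguerre_def coeff_sum)
next
  case True
  have 1: "pochhammer (- of_nat n :: complex) j = (-1) ^ j * of_nat (fact n) / of_nat (fact (n - j))"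
  proof -
    have "of_nat (n choose j) = ((-1) ^ j / fact j) * pochhammer (- of_nat n :: complex) j"
      by (simp add: binomial_gbinomial gbinomial_pochhammer)
    moreover have "of_nat (n choose j) = (fact n / (fact j * fact (n - j)) :: complex)"
      using True by (rule binomial_fact)
    ultimately show ?thesis by (simp add: field_simps)
  qed
  have 2: "pochhammer (of_nat \<alpha> + 1 :: complex) j = of_nat (fact (\<alpha> + j)) / of_nat (fact \<alpha>)"
  proof -
    have "pochhammer (1::complex) (\<alpha> + j) = pochhammer 1 \<alpha> * pochhammer (1 + of_nat \<alpha>) j"
      by (rule pochhammer_product')
    then show ?thesis by (simp add: pochhammer_fact[symmetric] field_simps)
  qed
  have 3: "of_nat ((n + \<alpha>) choose (\<alpha> + j)) = (fact (n + \<alpha>) / (fact (\<alpha> + j) * fact (n - j)) :: complex)"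
    using True by (subst binomial_fact) auto
  have "coeff (laguerre \<alpha> n) j = of_nat (fact (\<alpha> + n)) / (of_nat (fact \<alpha>) * of_nat (fact n)) *
     (pochhammer (- of_nat n) j / (pochhammer (of_nat \<alpha> + 1) j * of_nat (fact j)))"
    using True by (simp add: laguerre_def coeff_sum)
  then show ?thesis
    unfolding 1 2 3 by (simp add: add.commute mult.commute mult.left_commute)
qed

lemma coeff_laguerre_Suc:
  "of_nat (Suc j) * coeff (laguerre \<alpha> n) (Suc j)
     = - ((-1) ^ j * of_nat ((n + \<alpha>) choose Suc (\<alpha> + j)) / of_nat (fact j))"
proof -
  have "(of_nat (Suc j) :: complex) * (c / of_nat (fact (Suc j))) = c / of_nat (fact j)" for c
    unfolding fact_Suc of_nat_mult by (simp del: of_nat_Suc)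
  then show ?thesis by (simp add: coeff_laguerre del: of_nat_Suc fact_Suc binomial_Suc_Suc)
qed

lemma sum_choose_fixed_lower:
  "(\<Sum>m<n. (m + a) choose (a + j)) = (n + a) choose Suc (a + j)"
  by (induction n) auto

text \<open>Coefficientwise this is the hockey-stick identity
  \<open>sum_choose_fixed_lower\<close>.\<close>

lemma pderiv_laguerre: "pderiv (laguerre \<alpha> n) = - (\<Sum>m<n. laguerre \<alpha> m)"
proof (rule poly_eqI)
  fix j
  have "coeff (- (\<Sum>m<n. laguerre \<alpha> m)) j
      = - ((-1) ^ j * of_nat (\<Sum>m<n. (m + \<alpha>) choose (\<alpha> + j)) / of_nat (fact j))"
    by (simp add: coeff_sum coeff_laguerre sum_distrib_left sum_divide_distrib)
  also have "\<dots> = coeff (pderiv (laguerre \<alpha> n)) j"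
    by (simp add: sum_choose_fixed_lower coeff_pderiv coeff_laguerre_Suc del: of_nat_Suc binomial_Suc_Suc)
  finally show "coeff (pderiv (laguerre \<alpha> n)) j = coeff (- (\<Sum>m<n. laguerre \<alpha> m)) j" ..
qed

text \<open>Laguerre's equation \<open>x y'' + (\<alpha> + 1 - x) y' = - n y\<close>, written with
  the two generators of the algebra. On coefficients it is the two-term recurrence
  \<open>rec\<close>.\<close>

lemma laguerre_eigen:
  "Eop (laguerre \<alpha> n) + smult (of_nat (Suc \<alpha>)) (pderiv (laguerre \<alpha> n))
     = smult (- of_nat n) (laguerre \<alpha> n)"
proof (rule poly_eqI)
  fix j
  define a where "a = coeff (laguerre \<alpha> n)"
  have rec: "of_nat (Suc j) * of_nat (Suc (j + \<alpha>)) * a (Suc j) = (of_nat j - of_nat n) * a j"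
  proof (cases "j \<le> n")
    case True
    have "Suc (\<alpha> + j) * ((n + \<alpha>) choose Suc (\<alpha> + j)) = (n - j) * ((n + \<alpha>) choose (\<alpha> + j))"
      using binomial_absorb_comp[of "n + \<alpha>" "\<alpha> + j"] binomial_absorption[of "\<alpha> + j" "n + \<alpha>"]
      by (metis add.commute add_diff_cancel_left)
    then have binom: "of_nat (Suc (\<alpha> + j)) * of_nat ((n + \<alpha>) choose Suc (\<alpha> + j)) =
        (of_nat (n - j) * of_nat ((n + \<alpha>) choose (\<alpha> + j)) :: complex)"
      by (metis of_nat_mult)
    have "of_nat (Suc j) * of_nat (Suc (j + \<alpha>)) * a (Suc j)
        = of_nat (Suc (\<alpha> + j)) * (of_nat (Suc j) * a (Suc j))"
      by (simp add: mult.assoc mult.left_commute add.commute del: of_nat_Suc)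
    also have "\<dots> = - ((-1) ^ j * (of_nat (Suc (\<alpha> + j)) * of_nat ((n + \<alpha>) choose Suc (\<alpha> + j)))
        / of_nat (fact j))"
      unfolding a_def coeff_laguerre_Suc by (simp add: mult_ac del: of_nat_Suc binomial_Suc_Suc)
    also have "\<dots> = (of_nat j - of_nat n) * a j"
      unfolding binom using True
      by (simp add: a_def coeff_laguerre of_nat_diff algebra_simps diff_divide_distrib)
    finally show ?thesis .
  qed (simp add: a_def coeff_laguerre binomial_eq_0)
  have "coeff (Eop (laguerre \<alpha> n)) j = of_nat j * of_nat (Suc j) * a (Suc j) - of_nat j * a j"
    by (cases j) (simp_all add: Eop_def coeff_pderiv a_def)
  then have "coeff (Eop (laguerre \<alpha> n) + smult (of_nat (Suc \<alpha>)) (pderiv (laguerre \<alpha> n))) j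
      = of_nat (Suc j) * of_nat (Suc (j + \<alpha>)) * a (Suc j) - of_nat j * a j"
    by (simp add: coeff_pderiv a_def algebra_simps)
  also have "\<dots> = - of_nat n * a j" unfolding rec by (simp add: algebra_simps)
  finally show "coeff (Eop (laguerre \<alpha> n) + smult (of_nat (Suc \<alpha>)) (pderiv (laguerre \<alpha> n))) j
      = coeff (smult (- of_nat n) (laguerre \<alpha> n)) j" by (simp add: a_def)
qed

section \<open>Sequences obtained from the Laguerre polynomials by one operator of the
  algebra\<close>

lemma Dalg_linear:
  assumes "T \<in> Dalg"
  shows "T (p + q) = T p + T q" and "T (smult c p) = smult c (T p)"
proof -
  have "(\<forall>p q. T (p + q) = T p + T q) \<and> (\<forall>c p. T (smult c p) = smult c (T p))"
    using assms
    by induction (auto simp: smult_add_right pderiv_add pderiv_smult Eop_def algebra_simps smult_diff_right)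
  then show "T (p + q) = T p + T q" and "T (smult c p) = smult c (T p)" by auto
qed

lemma Dalg_zero: "T \<in> Dalg \<Longrightarrow> T 0 = 0"
  using Dalg_linear(2)[of T 0 0] by simp

lemma Dalg_sum: "T \<in> Dalg \<Longrightarrow> T (\<Sum>i\<in>I. f i) = (\<Sum>i\<in>I. T (f i))"
  by (induction I rule: infinite_finite_induct) (auto simp: Dalg_zero Dalg_linear)

text \<open>One operator \<open>T\<close> has to serve all \<open>n\<close>; the closure properties
  below translate operations on sequences into operations on operators.\<close>

definition realizable :: "nat \<Rightarrow> (nat \<Rightarrow> complex poly) \<Rightarrow> bool" where
  "realizable \<alpha> F \<longleftrightarrow> (\<exists>T\<in>Dalg. \<forall>n. T (laguerre \<alpha> n) = F n)"

lemma realizableI: "T \<in> Dalg \<Longrightarrow> (\<And>n. T (laguerre \<alpha> n) = F n) \<Longrightarrow> realizable \<alpha> F"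
  unfolding realizable_def by blast

lemma realizableE:
  assumes "realizable \<alpha> F"
  obtains T where "T \<in> Dalg" "\<And>n. T (laguerre \<alpha> n) = F n"
  using assms unfolding realizable_def by blast

lemma realizable_laguerre: "realizable \<alpha> (laguerre \<alpha>)"
  by (rule realizableI[OF Dalg.scalar[of 1]]) simp

lemma realizable_add:
  assumes "realizable \<alpha> F" and "realizable \<alpha> G"
  shows "realizable \<alpha> (\<lambda>n. F n + G n)"
proof -
  obtain S T where S: "S \<in> Dalg" "\<And>n. S (laguerre \<alpha> n) = F n"
    and T: "T \<in> Dalg" "\<And>n. T (laguerre \<alpha> n) = G n"
    using assms by (metis realizableE)
  show ?thesis by (rule realizableI[OF Dalg.add[OF S(1) T(1)]]) (simp only: S T)
qed

lemma realizable_smult: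
  assumes "realizable \<alpha> F" shows "realizable \<alpha> (\<lambda>n. smult c (F n))"
proof -
  obtain T where T: "T \<in> Dalg" "\<And>n. T (laguerre \<alpha> n) = F n"
    using assms by (rule realizableE) blast
  show ?thesis by (rule realizableI[OF Dalg.comp[OF Dalg.scalar T(1)]]) (simp only: T)
qed

lemma realizable_sum:
  "(\<And>i. i \<in> I \<Longrightarrow> realizable \<alpha> (F i)) \<Longrightarrow> realizable \<alpha> (\<lambda>n. \<Sum>i\<in>I. F i n)"
proof (induction I rule: infinite_finite_induct)
  case (insert x I)
  then show ?case using realizable_add[of \<alpha> "F x" "\<lambda>n. \<Sum>i\<in>I. F i n"] by simp
qed (use realizable_smult[OF realizable_laguerre, of \<alpha> 0] in auto)

lemma realizable_minus: "realizable \<alpha> F \<Longrightarrow> realizable \<alpha> (\<lambda>n. - F n)"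
  using realizable_smult[of \<alpha> F "-1"] by simp

text \<open>The order of the two factors is reversed: to multiply \<open>F n\<close> by a function of \<open>n\<close>,
  the operator with eigenvalue \<open>n\<close> on the Laguerre polynomials is applied first.\<close>
lemma realizable_mult_n:
  assumes "realizable \<alpha> F" shows "realizable \<alpha> (\<lambda>n. smult (of_nat n) (F n))"
proof -
  define H where "H = (\<lambda>p. smult (-1) (Eop p + smult (of_nat (Suc \<alpha>)) (pderiv p)))"
  have "H \<in> Dalg" unfolding H_def
    by (intro Dalg.comp[OF Dalg.scalar] Dalg.add Dalg.E Dalg.comp[OF Dalg.scalar Dalg.deriv])
  moreover have "H (laguerre \<alpha> n) = smult (of_nat n) (laguerre \<alpha> n)" for n
    unfolding H_def laguerre_eigen by simp
  moreover obtain T where "T \<in> Dalg" "\<And>n. T (laguerre \<alpha> n) = F n"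
    using assms by (rule realizableE) blast
  ultimately show ?thesis
    by (intro realizableI[OF Dalg.comp[of T H]]) (simp_all only: Dalg_linear(2)[of T])
qed

lemma realizable_mult_poly:
  assumes "realizable \<alpha> F" shows "realizable \<alpha> (\<lambda>n. smult (poly q (of_nat n)) (F n))"
proof (induction q)
  case 0
  then show ?case using realizable_smult[OF assms, of 0] by simp
next
  case (pCons a q)
  then show ?case
    using realizable_add[OF realizable_smult[OF assms, of a] realizable_mult_n[OF pCons.IH]]
    by (simp add: smult_add_left)
qed

text \<open>First \<open>S\<close>, which is 1 - d/dx, turns \<open>laguerre \<alpha> n\<close> into
  the unweighted sum; then \<open>T\<close> multiplies each summand by its own weight.\<close>

lemma realizable_sum_laguerre:
  "realizable \<alpha> (\<lambda>n. \<Sum>m\<le>n. smult (poly q (of_nat m)) (laguerre \<alpha> m))"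
proof -
  obtain T where T: "T \<in> Dalg" "\<And>n. T (laguerre \<alpha> n) = smult (poly q (of_nat n)) (laguerre \<alpha> n)"
    using realizable_mult_poly[OF realizable_laguerre, of \<alpha> q] by (rule realizableE) blast
  define S where "S = (\<lambda>p. smult 1 p + smult (-1) (pderiv p) :: complex poly)"
  have "S \<in> Dalg" unfolding S_def
    by (intro Dalg.add Dalg.scalar Dalg.comp[OF Dalg.scalar Dalg.deriv])
  moreover have "S (laguerre \<alpha> n) = (\<Sum>m\<le>n. laguerre \<alpha> m)" for n
    unfolding S_def pderiv_laguerre by (simp add: lessThan_Suc_atMost[symmetric])
  ultimately have "T (S (laguerre \<alpha> n)) = (\<Sum>m\<le>n. smult (poly q (of_nat m)) (laguerre \<alpha> m))" for n
    by (simp only: Dalg_sum[OF T(1)] T(2))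
  then show ?thesis by (rule realizableI[OF Dalg.comp[OF T(1) \<open>S \<in> Dalg\<close>]])
qed

text \<open>Induction over the algebra. Closure under composition reduces to closure under sums,
  multiplication by a polynomial from the left and, by the product rule, differentiation from the
  left.\<close>

lemma Dalg_differential_form:
  assumes "T \<in> Dalg"
  shows "\<exists>m q. \<forall>p. T p = (\<Sum>j\<le>m. q j * (pderiv ^^ j) p)"
proof -
  define dform :: "(complex poly \<Rightarrow> complex poly) \<Rightarrow> bool"
    where "dform T \<longleftrightarrow> (\<exists>m q. \<forall>p. T p = (\<Sum>j\<le>m. q j * (pderiv ^^ j) p))" for T
  have add: "dform (\<lambda>p. S p + T p)" if "dform S" "dform T" for S T
  proof -
    from that obtain m1 q1 m2 q2 where
      S: "\<And>p. S p = (\<Sum>j\<le>m1. q1 j * (pderiv ^^ j) p)" and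
      T: "\<And>p. T p = (\<Sum>j\<le>m2. q2 j * (pderiv ^^ j) p)" unfolding dform_def by blast
    define m where "m = max m1 m2"
    have 1: "S p = (\<Sum>j\<le>m. (if j \<le> m1 then q1 j else 0) * (pderiv ^^ j) p)" for p
      unfolding S m_def by (rule sum.mono_neutral_cong_left) auto
    have 2: "T p = (\<Sum>j\<le>m. (if j \<le> m2 then q2 j else 0) * (pderiv ^^ j) p)" for p
      unfolding T m_def by (rule sum.mono_neutral_cong_left) auto
    show ?thesis unfolding dform_def 1 2 sum.distrib[symmetric] distrib_right[symmetric]
      by (intro exI allI) (rule refl)
  qed
  have mult: "dform (\<lambda>p. r * T p)" if T: "dform T" for r T
  proof -
    obtain m q where "\<And>p. T p = (\<Sum>j\<le>m. q j * (pderiv ^^ j) p)"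
      using T unfolding dform_def by blast
    then have "\<forall>p. r * T p = (\<Sum>j\<le>m. (r * q j) * (pderiv ^^ j) p)"
      by (simp add: sum_distrib_left mult.assoc)
    then show ?thesis unfolding dform_def by (intro exI[of _ m] exI[of _ "\<lambda>j. r * q j"])
  qed
  have id: "dform (\<lambda>p. p)"
    unfolding dform_def by (rule exI[of _ 0], rule exI[of _ "\<lambda>_. 1"]) simp
  have sum: "dform (\<lambda>p. \<Sum>j\<le>m. F j p)" if "\<And>j. dform (F j)" for F and m :: nat
    by (induction m) (use that add in auto)
  have deriv: "dform (\<lambda>p. pderiv (T p))" if T: "dform T" for T
  proof -
    obtain m q where q: "\<And>p. T p = (\<Sum>j\<le>m. q j * (pderiv ^^ j) p)"
      using T unfolding dform_def by blast
    have "dform (\<lambda>p. (pderiv ^^ j) p)" for j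
    proof -
      have "\<forall>p. (pderiv ^^ j) p = (\<Sum>i\<le>j. (if i = j then 1 else 0) * (pderiv ^^ i) p)"
        by (simp add: if_distrib[of "\<lambda>x. x * _"] cong: if_cong)
      then show ?thesis unfolding dform_def
        by (intro exI[of _ j] exI[of _ "\<lambda>i. if i = j then 1 else 0"])
    qed
    from this[of "Suc _"] this have
      "dform (\<lambda>p. \<Sum>j\<le>m. q j * (pderiv ^^ Suc j) p + pderiv (q j) * (pderiv ^^ j) p)"
      by (intro sum add mult)
    then show ?thesis
      unfolding q by (simp add: pderiv_sum pderiv_mult add.commute mult.commute)
  qed
  have comp: "dform (\<lambda>p. S (T p))" if S: "dform S" and T: "dform T" for S T
  proof -
    obtain m q where q: "\<And>p. S p = (\<Sum>j\<le>m. q j * (pderiv ^^ j) p)"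
      using S unfolding dform_def by blast
    have "dform (\<lambda>p. (pderiv ^^ j) (T p))" for j
      by (induction j) (use T deriv in auto)
    then show ?thesis unfolding q by (intro sum mult)
  qed
  have "dform T"
    using assms
  proof induction
    case (scalar c)
    show ?case using mult[OF id, of "[:c:]"] by simp
  next
    case E
    have "dform (\<lambda>p. [:0, 1:] * pderiv (pderiv p) + (- [:0, 1:]) * pderiv p)"
      by (intro add mult deriv id)
    then show ?case by (simp add: Eop_def[abs_def])
  qed (auto intro: add comp deriv id)
  then show ?thesis unfolding dform_def .
qed

lemma Dalg_ops_diffop:
  assumes "B \<in> Dalg_ops" shows "is_diffop B"
proof -
  obtain T where T: "T \<in> Dalg" "B = (\<lambda>p. poly (T p))" using assms by (auto simp: Dalg_ops_def)
  obtain m q where "\<And>p. T p = (\<Sum>j\<le>m. q j * (pderiv ^^ j) p)"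
    using Dalg_differential_form[OF T(1)] by blast
  then have "B = (\<lambda>p x. \<Sum>j\<le>m. poly (q j) x * poly ((pderiv ^^ j) p) x)"
    by (intro ext) (simp add: T(2) poly_sum)
  then show ?thesis
    unfolding is_diffop_def by (intro exI[of _ m] exI[of _ "\<lambda>j. poly (q j)"])
qed

lemma diffop_linear:
  assumes "is_diffop B"
  shows "B (p + q) x = B p x + B q x" and "B (smult c p) x = c * B p x"
proof -
  obtain m b where B: "B = (\<lambda>p x. \<Sum>j\<le>m. b j x * poly ((pderiv ^^ j) p) x)"
    using assms unfolding is_diffop_def by blast
  have 1: "(pderiv ^^ j) (p + q) = (pderiv ^^ j) p + (pderiv ^^ j) q" for j
    by (induction j) (auto simp: pderiv_add)
  have 2: "(pderiv ^^ j) (smult c p) = smult c ((pderiv ^^ j) p)" for j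
    by (induction j) (auto simp: pderiv_smult)
  show "B (p + q) x = B p x + B q x"
    by (simp add: B 1 algebra_simps sum.distrib)
  show "B (smult c p) x = c * B p x"
    by (simp add: B 2 sum_distrib_left mult.left_commute)
qed

text \<open>Polynomials with exactly one of each degree form a basis; the induction on the degree
  subtracts the leading term.\<close>

lemma diffop_eqI:
  assumes B: "is_diffop B" "is_diffop B'"
    and P: "\<And>n. degree (P n) = n" "P 0 \<noteq> 0"
    and eq: "\<And>n. B (P n) = B' (P n)"
  shows "B = B'"
proof
  fix p
  have zero: "D 0 x = 0" if "is_diffop D" for D x
    using diffop_linear(2)[OF that, of 0 0] by simp
  show "B p = B' p"
  proof (induction "degree p" arbitrary: p rule: less_induct)
    case less
    define n where "n = degree p"
    define c where "c = lead_coeff p / lead_coeff (P n)"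
    define r where "r = p - smult c (P n)"
    have Pn: "P n \<noteq> 0" using P by (metis degree_0)
    then have "coeff (P n) n \<noteq> 0" using P(1)[of n] by (metis leading_coeff_0_iff)
    then have "coeff r n = 0" using P(1)[of n] by (simp add: r_def c_def n_def)
    moreover have "degree r \<le> n" unfolding r_def using P(1)[of n]
      by (intro degree_diff_le) (auto simp: n_def intro: order_trans[OF degree_smult_le])
    ultimately have "r = 0 \<or> degree r < n"
      by (metis eq_zero_or_degree_less)
    then have r: "B r = B' r" using less zero[OF B(1)] zero[OF B(2)] by (auto simp: n_def)
    have p: "p = r + smult c (P n)" by (simp add: r_def)
    show "B p = B' p"
      by (subst (1 2) p, intro ext) (simp add: diffop_linear[OF B(1)] diffop_linear[OF B(2)] r eq)
  qed
qed

section \<open>Eigenoperators in the algebra\<close>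

text \<open>In the application \<open>c i\<close> are the cofactors at \<open>n\<close>,
  \<open>l i\<close> is the Laguerre polynomial of index \<open>n - i\<close>, and
  \<open>S j\<close> minus the inner sum is the weighted sum up to \<open>n - i\<close>. By
  \<open>orth\<close> the terms \<open>S j\<close> drop out, and exchanging the order of the
  remaining double sum gives the left side of \<open>key\<close>.\<close>

lemma orthogonal_summation_by_parts:
  fixes c H l :: "nat \<Rightarrow> 'a :: comm_ring_1"
  assumes orth: "\<And>j. j < k \<Longrightarrow> (\<Sum>i\<le>k. c i * \<psi> j i) = 0"
    and key: "\<And>i. i \<le> k \<Longrightarrow> (\<Sum>i'\<in>{i<..k}. c i' * (\<Sum>j<k. \<psi> j i' * w j i)) = (h - H i) * c i"
  shows "(\<Sum>i\<le>k. c i * (H i * l i - (\<Sum>j<k. \<psi> j i * (S j - (\<Sum>i'<i. w j i' * l i')))))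
           = h * (\<Sum>i\<le>k. c i * l i)"
proof -
  have "(\<Sum>i\<le>k. c i * (\<Sum>j<k. \<psi> j i * S j)) = (\<Sum>j<k. S j * (\<Sum>i\<le>k. c i * \<psi> j i))"
    by (simp add: sum_distrib_left mult_ac sum.swap[of _ "{..<k}" "{..k}"])
  then have 1: "(\<Sum>i\<le>k. c i * (\<Sum>j<k. \<psi> j i * S j)) = 0" using orth by simp
  have "(\<Sum>i\<le>k. c i * (\<Sum>j<k. \<psi> j i * (\<Sum>i'<i. w j i' * l i')))
      = (\<Sum>i\<le>k. \<Sum>i'<i. l i' * (c i * (\<Sum>j<k. \<psi> j i * w j i')))"
    by (intro sum.cong refl) (simp add: sum_distrib_left mult_ac sum.swap[of _ "{..<k}"])
  also have "\<dots> = (\<Sum>i'\<le>k. \<Sum>i\<in>{i'<..k}. l i' * (c i * (\<Sum>j<k. \<psi> j i * w j i')))"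
    unfolding sum.Sigma[OF finite_atMost ballI[OF finite_lessThan]]
      sum.Sigma[OF finite_atMost ballI[OF finite_greaterThanAtMost]]
    by (rule sum.reindex_bij_witness[of _ "\<lambda>(i, j). (j, i)" "\<lambda>(i, j). (j, i)"]) auto
  also have "\<dots> = (\<Sum>i\<le>k. l i * ((h - H i) * c i))"
    by (intro sum.cong refl) (simp add: sum_distrib_left[symmetric] key)
  finally have 2: "(\<Sum>i\<le>k. c i * (\<Sum>j<k. \<psi> j i * (\<Sum>i'<i. w j i' * l i')))
      = (\<Sum>i\<le>k. l i * ((h - H i) * c i))" .
  have "(\<Sum>i\<le>k. c i * (H i * l i - (\<Sum>j<k. \<psi> j i * (S j - (\<Sum>i'<i. w j i' * l i')))))
      = (\<Sum>i\<le>k. c i * (H i * l i)) - (\<Sum>i\<le>k. c i * (\<Sum>j<k. \<psi> j i * S j))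
        + (\<Sum>i\<le>k. c i * (\<Sum>j<k. \<psi> j i * (\<Sum>i'<i. w j i' * l i')))"
    unfolding sum_subtractf[symmetric] sum.distrib[symmetric]
    by (intro sum.cong refl) (simp add: algebra_simps sum_subtractf)
  also have "\<dots> = h * (\<Sum>i\<le>k. c i * l i)"
    unfolding 1 2 by (simp add: sum_distrib_left sum.distrib[symmetric] algebra_simps)
  finally show ?thesis .
qed

definition darboux_weight :: "(nat \<Rightarrow> complex poly) \<Rightarrow> nat \<Rightarrow> complex poly \<Rightarrow> nat \<Rightarrow> complex poly" where
  "darboux_weight g k s j = (\<Sum>r<k. pcompose
     (s * cofactor (mat k k (\<lambda>(i, j). shiftp (g i) j)) j r) [: of_nat r, 1 :])"

text \<open>This is the condition \<open>key\<close> above. The weights make the summand for each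
  \<open>r\<close> collapse to a value of \<open>s\<close> times the Wronskian, a difference of
  \<open>h\<close>, and these differences telescope.\<close>

lemma wr_cofactor_darboux_weight:
  fixes z :: complex
  assumes s: "\<And>z. poly s z * poly (wr_poly g k) z = poly h (z + 1) - poly h z"
    and l: "l \<le> k"
  shows "(\<Sum>i\<in>{l<..k}. poly (wr_cofactor g k i) z *
            (\<Sum>j<k. poly (g j) (z - of_nat i) * poly (darboux_weight g k s j) (z - of_nat l)))
     = (poly h z - poly h (z - of_nat l + of_nat k)) * poly (wr_cofactor g k l) z"
proof -
  define C where "C i = poly (wr_cofactor g k i) z" for i
  define y where "y r = z - of_nat l + of_nat r" for r
  define K where "K = mat k k (\<lambda>(i, j). shiftp (g i) j)"
  define D where "D r i = (\<Sum>j<k. poly (g j) (z - of_nat i) * poly (cofactor K j r) (y r))" for r i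
  define t where "t r = poly (wr_poly g k) (y r)" for r
  have orth: "(\<Sum>i\<le>k. C i * poly (g j) (z - of_nat i)) = 0" if "j < k" for j
    using arg_cong[OF wr_cofactor_orthogonal[OF that, of g], of "\<lambda>p. poly p z"]
    by (simp add: poly_sum poly_shiftp C_def mult.commute)
  \<comment> \<open>The cofactors taken at \<open>y r\<close> see the points
    \<open>y r, ..., y r - (k - 1)\<close>; the bounds on \<open>i + r\<close> say that
    \<open>z - i\<close> is among them.\<close>
  have D: "D r i = (if i = l then t r else 0)" if "r < k" "l \<le> i + r" "i + r < l + k" for r i
  proof -
    have "z - of_nat i = y r - of_nat (i + r - l)" using that by (simp add: y_def of_nat_diff)
    then have "D r i = poly (\<Sum>j<k. shiftp (g j) (i + r - l) * cofactor K j r) (y r)"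
      by (simp add: D_def poly_sum poly_shiftp)
    also have "\<dots> = (if i = l then t r else 0)"
      unfolding K_def by (subst wr_poly_inverse) (use that in \<open>auto simp: t_def\<close>)
    finally show ?thesis .
  qed
  have D_orth: "(\<Sum>i\<le>k. C i * D r i) = 0" for r
  proof -
    have "(\<Sum>i\<le>k. C i * D r i)
        = (\<Sum>j<k. poly (cofactor K j r) (y r) * (\<Sum>i\<le>k. C i * poly (g j) (z - of_nat i)))"
      unfolding D_def by (simp add: sum_distrib_left mult_ac sum.swap[of _ "{..<k}" "{..k}"])
    then show ?thesis using orth by simp
  qed
  have T: "(\<Sum>i\<in>{l<..k}. C i * D r i) = (if l \<le> r then - (C l * t r) else 0)" if r: "r < k" for r
  proof (cases "l \<le> r")
    case False
    then have "D r i = 0" if "i \<in> {l<..k}" for i using D[OF r, of i] that by auto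
    then show ?thesis using False by simp
  next
    \<comment> \<open>For \<open>i > l\<close> the point may leave the window, but all
      \<open>i \<le> l\<close> lie in it, so orthogonality moves the sum to that side, where only
      \<open>i = l\<close> survives.\<close>
    case True
    have "{..k} = {..l} \<union> {l<..k}" using l by auto
    then have "(\<Sum>i\<le>k. C i * D r i) = (\<Sum>i\<le>l. C i * D r i) + (\<Sum>i\<in>{l<..k}. C i * D r i)"
      by (simp only:) (rule sum.union_disjoint, auto)
    moreover have "(\<Sum>i\<le>l. C i * D r i) = (\<Sum>i\<le>l. if i = l then C l * t r else 0)"
      using True r D[OF r] by (intro sum.cong) auto
    ultimately show ?thesis using True D_orth[of r] by (simp add: eq_neg_iff_add_eq_0 add.commute)
  qed
  have "(\<Sum>i\<in>{l<..k}. C i * (\<Sum>j<k. poly (g j) (z - of_nat i) * poly (darboux_weight g k s j) (z - of_nat l)))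
      = (\<Sum>i\<in>{l<..k}. C i * (\<Sum>j<k. \<Sum>r<k. poly (g j) (z - of_nat i) * (poly s (y r) * poly (cofactor K j r) (y r))))"
    by (simp add: darboux_weight_def poly_sum poly_pcompose K_def[symmetric] y_def sum_distrib_left add.commute)
  also have "\<dots> = (\<Sum>i\<in>{l<..k}. \<Sum>r<k. poly s (y r) * (C i * D r i))"
    unfolding D_def sum_distrib_left by (rule sum.cong[OF refl], subst sum.swap) (simp add: mult_ac)
  also have "\<dots> = (\<Sum>r<k. poly s (y r) * (\<Sum>i\<in>{l<..k}. C i * D r i))"
    by (subst sum.swap) (simp add: sum_distrib_left)
  also have "\<dots> = (\<Sum>r<k. if l \<le> r then - C l * (poly s (y r) * t r) else 0)"
    by (intro sum.cong) (auto simp: T)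
  also have "\<dots> = (\<Sum>r\<in>{l..<k}. - C l * (poly s (y r) * t r))"
    by (rule sum.mono_neutral_cong_right) auto
  \<comment> \<open>The shift by one in \<open>s\<close> makes consecutive terms telescope, with
    \<open>y l = z\<close>.\<close>
  also have "\<dots> = - C l * (\<Sum>r\<in>{l..<k}. poly h (y (Suc r)) - poly h (y r))"
    by (simp add: t_def s sum_distrib_left y_def algebra_simps)
  also have "\<dots> = - C l * (poly h (y k) - poly h (y l))"
    using sum_Suc_diff'[OF l, of "\<lambda>r. poly h (y r)"] by simp
  finally show ?thesis by (simp add: C_def y_def algebra_simps)
qed

text \<open>The operator is \<open>h(H + k) - (\<Sum>j. w\<^sub>j(H) (1 - d/dx) \<psi>\<^sub>j(H))\<close>, where \<open>H\<close> has eigenvalue \<open>n\<close>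
  on the Laguerre polynomials and \<open>w\<^sub>j\<close> are the weights above.\<close>
lemma Dalg_eigen_operator:
  assumes dvd: "shiftp (wr_poly g k) 1 dvd h - shiftp h 1"
  obtains T where "T \<in> Dalg" and
    "\<And>n. T (\<Sum>i\<le>k. smult (poly (wr_cofactor g k i) (of_nat n)) (laguerre_int \<alpha> (int n - int i)))
       = smult (poly h (of_nat n))
           (\<Sum>i\<le>k. smult (poly (wr_cofactor g k i) (of_nat n)) (laguerre_int \<alpha> (int n - int i)))"
proof -
  obtain q where q: "h - shiftp h 1 = shiftp (wr_poly g k) 1 * q" using dvd by blast
  define s where "s = pcompose q [:1, 1:]"
  have s: "poly s z * poly (wr_poly g k) z = poly h (z + 1) - poly h z" for z
    using arg_cong[OF q, of "\<lambda>p. poly p (z + 1)"]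
    by (simp add: s_def poly_pcompose poly_shiftp add.commute mult.commute)
  define w where "w = darboux_weight g k s"
  \<comment> \<open>For negative \<open>m\<close> the sum is empty. Hence \<open>F m = 0\<close>
    there, in accordance with the zero Laguerre polynomials of negative index, and the step relation
    for \<open>S\<close> holds for all integers.\<close>
  define S where "S j m = (\<Sum>t<nat (m + 1). smult (poly (w j) (of_nat t)) (laguerre \<alpha> t))" for j and m :: int
  define F where "F m = smult (poly h (of_int m + of_nat k)) (laguerre_int \<alpha> m)
      - (\<Sum>j<k. smult (poly (g j) (of_int m)) (S j m))" for m
  have "realizable \<alpha> (\<lambda>n. smult (poly (pcompose h [:of_nat k, 1:]) (of_nat n)) (laguerre \<alpha> n)
      + - (\<Sum>j<k. smult (poly (g j) (of_nat n)) (\<Sum>t\<le>n. smult (poly (w j) (of_nat t)) (laguerre \<alpha> t))))"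
    by (intro realizable_add realizable_minus realizable_sum realizable_mult_poly
        realizable_laguerre realizable_sum_laguerre)
  also have "(\<lambda>n. smult (poly (pcompose h [:of_nat k, 1:]) (of_nat n)) (laguerre \<alpha> n)
      + - (\<Sum>j<k. smult (poly (g j) (of_nat n)) (\<Sum>t\<le>n. smult (poly (w j) (of_nat t)) (laguerre \<alpha> t))))
      = (\<lambda>n. F (int n))"
  proof
    fix n
    have "nat (int n + 1) = Suc n" by simp
    then show "smult (poly (pcompose h [:of_nat k, 1:]) (of_nat n)) (laguerre \<alpha> n)
      + - (\<Sum>j<k. smult (poly (g j) (of_nat n)) (\<Sum>t\<le>n. smult (poly (w j) (of_nat t)) (laguerre \<alpha> t)))
      = F (int n)"
      by (simp add: F_def S_def laguerre_int_def poly_pcompose lessThan_Suc_atMost add.commute del: sum.lessThan_Suc)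
  qed
  finally obtain T where T: "T \<in> Dalg" "\<And>n. T (laguerre \<alpha> n) = F (int n)"
    by (rule realizableE) blast
  have TF: "T (laguerre_int \<alpha> m) = F m" for m
  proof (cases "m < 0")
    case True
    then show ?thesis by (simp add: laguerre_int_def F_def S_def Dalg_zero[OF T(1)])
  next
    case False
    then show ?thesis using T(2)[of "nat m"] by (simp add: laguerre_int_def)
  qed
  have S_step: "S j (m - 1) = S j m - smult (poly (w j) (of_int m)) (laguerre_int \<alpha> m)" for j m
  proof (cases "m < 0")
    case False
    then have "nat (m + 1) = Suc (nat m)" by auto
    then show ?thesis using False by (simp add: S_def laguerre_int_def)
  qed (simp add: S_def laguerre_int_def)
  have S_shift: "S j (m - int i) = S j m -
      (\<Sum>l<i. smult (poly (w j) (of_int m - of_nat l)) (laguerre_int \<alpha> (m - int l)))" for j m i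
  proof (induction i)
    case (Suc i)
    have eq: "m - int (Suc i) = (m - int i) - 1" by simp
    show ?case unfolding eq S_step[of j "m - int i"] Suc.IH by (simp add: algebra_simps)
  qed simp
  show thesis
  proof (rule that[OF T(1)])
    fix n
    define C where "C i = poly (wr_cofactor g k i) (of_nat n)" for i
    define L where "L i = laguerre_int \<alpha> (int n - int i)" for i
    have "T (\<Sum>i\<le>k. smult (C i) (L i)) = (\<Sum>i\<le>k. smult (C i) (F (int n - int i)))"
      by (simp add: Dalg_sum[OF T(1)] Dalg_linear(2)[OF T(1)] TF L_def)
    also have "\<dots> = smult (poly h (of_nat n)) (\<Sum>i\<le>k. smult (C i) (L i))"
    proof (rule poly_eqI_of_nat[of 0])
      fix x
      have "poly (\<Sum>i\<le>k. smult (C i) (F (int n - int i))) (of_nat x) =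
        (\<Sum>i\<le>k. C i * (poly h (of_nat n - of_nat i + of_nat k) * poly (L i) (of_nat x)
           - (\<Sum>j<k. poly (g j) (of_nat n - of_nat i) * (poly (S j (int n)) (of_nat x)
                - (\<Sum>l<i. poly (w j) (of_nat n - of_nat l) * poly (L l) (of_nat x))))))"
        by (simp add: poly_sum F_def S_shift L_def)
      also have "\<dots> = poly h (of_nat n) * (\<Sum>i\<le>k. C i * poly (L i) (of_nat x))"
      proof (rule orthogonal_summation_by_parts)
        fix j assume "j < k"
        then show "(\<Sum>i\<le>k. C i * poly (g j) (of_nat n - of_nat i)) = 0"
          using arg_cong[OF wr_cofactor_orthogonal[of j k g], of "\<lambda>p. poly p (of_nat n)"]
          by (simp add: poly_sum poly_shiftp C_def mult.commute)
      next
        fix i assume "i \<le> k"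
        then show "(\<Sum>i'\<in>{i<..k}. C i' * (\<Sum>j<k. poly (g j) (of_nat n - of_nat i') * poly (w j) (of_nat n - of_nat i)))
            = (poly h (of_nat n) - poly h (of_nat n - of_nat i + of_nat k)) * C i"
          unfolding C_def w_def by (rule wr_cofactor_darboux_weight[OF s])
      qed
      finally show "poly (\<Sum>i\<le>k. smult (C i) (F (int n - int i))) (of_nat x)
          = poly (smult (poly h (of_nat n)) (\<Sum>i\<le>k. smult (C i) (L i))) (of_nat x)"
        by (simp add: poly_sum)
    qed
    finally show "T (\<Sum>i\<le>k. smult (poly (wr_cofactor g k i) (of_nat n)) (laguerre_int \<alpha> (int n - int i)))
       = smult (poly h (of_nat n))
           (\<Sum>i\<le>k. smult (poly (wr_cofactor g k i) (of_nat n)) (laguerre_int \<alpha> (int n - int i)))"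
      unfolding C_def L_def .
  qed
qed

section \<open>The eigenvalue equation at the origin\<close>

lemma poly_binpoly: "poly (binpoly a) x = (x + of_nat a) gchoose a"
  by (simp add: binpoly_def poly_prod gbinomial_pochhammer' pochhammer_prod prod.atLeast1_atMost_eq
      atLeast0LessThan algebra_simps)

lemma poly_0_higher_pderiv:
  fixes p :: "complex poly"
  shows "poly ((pderiv ^^ j) p) 0 = fact j * coeff p j"
proof -
  have "fact i * coeff ((pderiv ^^ j) p) i = fact (i + j) * coeff p (i + j)" for i
  proof (induction j arbitrary: i)
    case (Suc j)
    have "fact i * coeff ((pderiv ^^ Suc j) p) i = fact (Suc i) * coeff ((pderiv ^^ j) p) (Suc i)"
      by (simp add: coeff_pderiv algebra_simps)
    then show ?case using Suc.IH[of "Suc i"] by (simp add: algebra_simps)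
  qed simp
  from this[of 0] show ?thesis by (simp add: poly_0_coeff_0)
qed

text \<open>The \<open>j\<close>-th derivative of the Laguerre polynomial at 0 as a polynomial in
  \<open>n\<close>. The shift by \<open>j\<close> turns \<open>binpoly (\<alpha> + j)\<close> into
  the binomial coefficient of \<open>n + \<alpha>\<close> over \<open>\<alpha> + j\<close>.\<close>

definition laguerre_deriv0 :: "nat \<Rightarrow> nat \<Rightarrow> complex poly" where
  "laguerre_deriv0 \<alpha> j = smult ((-1) ^ j) (shiftp (binpoly (\<alpha> + j)) j)"

lemma poly_laguerre_deriv0:
  "poly (laguerre_deriv0 \<alpha> j) (of_nat n) = fact j * coeff (laguerre \<alpha> n) j"
proof -
  have "poly (laguerre_deriv0 \<alpha> j) (of_nat n) = (-1) ^ j * (of_nat (n + \<alpha>) gchoose (\<alpha> + j))"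
    by (simp add: laguerre_deriv0_def poly_shiftp poly_binpoly add.commute)
  then show ?thesis by (simp add: coeff_laguerre binomial_gbinomial)
qed

lemma laguerre_deriv0_0 [simp]: "laguerre_deriv0 \<alpha> 0 = binpoly \<alpha>"
  by (simp add: laguerre_deriv0_def)

text \<open>The cofactor vectors of the Wronskians at \<open>n\<close> and at \<open>n - 1\<close>, restricted to their common window
  \<open>n - 1, \<dots>, n - k\<close>, solve linear systems with the matrix of \<open>\<tau>(n - 1)\<close>: the equations
  \<open>wr_cofactor_orthogonal\<close> involve one further point each, where the cofactor is \<open>\<plusminus>\<tau>(n - 1)\<close>.\<close>
lemma wr_poly_dvd_cofactor_minor:
  assumes nz: "wr_poly g k \<noteq> 0" and ab: "a < k" "b < k"
  shows "shiftp (wr_poly g k) 1 dvd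
    wr_cofactor g k (Suc a) * shiftp (wr_cofactor g k b) 1
      - wr_cofactor g k (Suc b) * shiftp (wr_cofactor g k a) 1"
proof -
  let ?C = "wr_cofactor g k"
  define A where "A = mat k k (\<lambda>(r, j). shiftp (g r) (Suc j))"
  have A: "A \<in> carrier_mat k k" by (simp add: A_def)
  have "A = map_mat (\<lambda>p. shiftp p 1) (mat k k (\<lambda>(r, j). shiftp (g r) j))"
    by (intro eq_matI) (auto simp: A_def shiftp_shiftp)
  then have det: "det A = shiftp (wr_poly g k) 1"
    by (simp add: wr_poly_def comm_ring_hom.hom_det[OF comm_ring_hom_shiftp])
  have mult: "(A *\<^sub>v vec k u) $ r = (\<Sum>j<k. shiftp (g r) (Suc j) * u j)" if "r < k" for u r
    using that by (auto simp: A_def scalar_prod_def lessThan_atLeast0 intro!: sum.cong)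
  have "A *\<^sub>v vec k (\<lambda>i. ?C (Suc i)) = det A \<cdot>\<^sub>v vec k (\<lambda>r. - ((-1) ^ k * g r))"
  proof (rule eq_vecI)
    fix r assume "r < dim_vec (det A \<cdot>\<^sub>v vec k (\<lambda>r. - ((-1) ^ k * g r)))"
    then have r: "r < k" by simp
    have "g r * ?C 0 + (\<Sum>j<k. shiftp (g r) (Suc j) * ?C (Suc j)) = 0"
      using wr_cofactor_orthogonal[OF r, of g] by (simp add: sum.atMost_shift)
    then show "(A *\<^sub>v vec k (\<lambda>i. ?C (Suc i))) $ r = (det A \<cdot>\<^sub>v vec k (\<lambda>r. - ((-1) ^ k * g r))) $ r"
      using r by (simp add: mult det wr_cofactor_0 add_eq_0_iff mult_ac)
  qed (simp add: A_def)
  moreover have "A *\<^sub>v vec k (\<lambda>i. shiftp (?C i) 1) = det A \<cdot>\<^sub>v vec k (\<lambda>r. - shiftp (g r) (Suc k))"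
  proof (rule eq_vecI)
    fix r assume "r < dim_vec (det A \<cdot>\<^sub>v vec k (\<lambda>r. - shiftp (g r) (Suc k)))"
    then have r: "r < k" by simp
    have "shiftp (\<Sum>j\<le>k. shiftp (g r) j * ?C j) 1 = 0"
      unfolding wr_cofactor_orthogonal[OF r] by (simp add: shiftp_eq_0_iff)
    then have "(\<Sum>j<k. shiftp (g r) (Suc j) * shiftp (?C j) 1)
        + shiftp (g r) (Suc k) * shiftp (wr_poly g k) 1 = 0"
      by (simp add: shiftp_sum shiftp_add shiftp_mult shiftp_shiftp wr_cofactor_last lessThan_Suc_atMost[symmetric])
    then show "(A *\<^sub>v vec k (\<lambda>i. shiftp (?C i) 1)) $ r = (det A \<cdot>\<^sub>v vec k (\<lambda>r. - shiftp (g r) (Suc k))) $ r"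
      using r by (simp add: mult det add_eq_0_iff2 mult.commute)
  qed (simp add: A_def)
  moreover have "det A \<noteq> 0" using nz by (simp add: det shiftp_eq_0_iff)
  ultimately have "det A dvd vec k (\<lambda>i. ?C (Suc i)) $ a * vec k (\<lambda>i. shiftp (?C i) 1) $ b
      - vec k (\<lambda>i. ?C (Suc i)) $ b * vec k (\<lambda>i. shiftp (?C i) 1) $ a"
    using det_dvd_minor_of_solutions[OF A] ab vec_carrier by metis
  then show ?thesis using ab by (simp add: det)
qed

text \<open>The Wronskian with \<open>f\<close> appended, in expanded form, which shows its
  linearity in \<open>f\<close>.\<close>

definition wr_append :: "(nat \<Rightarrow> complex poly) \<Rightarrow> nat \<Rightarrow> complex poly \<Rightarrow> complex poly" where
  "wr_append g k f = (\<Sum>i\<le>k. shiftp f i * wr_cofactor g k i)"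

text \<open>The term outside the common window carries the cofactor
  \<open>wr_cofactor g k 0\<close>, a multiple of the Wronskian at \<open>n - 1\<close>. In the
  shifted version below this is the last cofactor.\<close>

lemma wr_append_window:
  obtains c where "wr_append g k f
      = (\<Sum>i<k. shiftp f (Suc i) * wr_cofactor g k (Suc i)) + shiftp (wr_poly g k) 1 * c"
proof (rule that)
  show "wr_append g k f = (\<Sum>i<k. shiftp f (Suc i) * wr_cofactor g k (Suc i))
      + shiftp (wr_poly g k) 1 * ((-1) ^ k * f)"
    by (simp add: wr_append_def sum.atMost_shift wr_cofactor_0 mult_ac)
qed

lemma shiftp_wr_append_window:
  obtains c where "shiftp (wr_append g k f) 1
      = (\<Sum>i<k. shiftp f (Suc i) * shiftp (wr_cofactor g k i) 1) + shiftp (wr_poly g k) 1 * c"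
proof (rule that)
  show "shiftp (wr_append g k f) 1 = (\<Sum>i<k. shiftp f (Suc i) * shiftp (wr_cofactor g k i) 1)
      + shiftp (wr_poly g k) 1 * shiftp f (Suc k)"
    by (simp add: wr_append_def shiftp_sum shiftp_add shiftp_mult shiftp_shiftp wr_cofactor_last
        lessThan_Suc_atMost[symmetric] mult.commute)
qed

text \<open>Modulo the Wronskian at \<open>n - 1\<close>, this is the combination of the cofactor
  minors with the values of \<open>f\<close> on the window. The next lemma repeats this with
  \<open>f'\<close> in the other factor.\<close>

lemma wr_poly_dvd_append_cofactor:
  assumes nz: "wr_poly g k \<noteq> 0" and b: "b < k"
  shows "shiftp (wr_poly g k) 1 dvd wr_append g k f * shiftp (wr_cofactor g k b) 1
           - wr_cofactor g k (Suc b) * shiftp (wr_append g k f) 1"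
proof -
  let ?C = "wr_cofactor g k" and ?d = "shiftp (wr_poly g k) 1"
  obtain c where c: "wr_append g k f = (\<Sum>i<k. shiftp f (Suc i) * ?C (Suc i)) + ?d * c"
    by (rule wr_append_window)
  obtain c' where c': "shiftp (wr_append g k f) 1 = (\<Sum>i<k. shiftp f (Suc i) * shiftp (?C i) 1) + ?d * c'"
    by (rule shiftp_wr_append_window)
  have eq: "wr_append g k f * shiftp (?C b) 1 - ?C (Suc b) * shiftp (wr_append g k f) 1
      = (\<Sum>i<k. shiftp f (Suc i) * (?C (Suc i) * shiftp (?C b) 1 - ?C (Suc b) * shiftp (?C i) 1))
        + ?d * (c * shiftp (?C b) 1 - ?C (Suc b) * c')"
    unfolding c' unfolding c by (simp add: algebra_simps sum_distrib_left sum_distrib_right sum_subtractf)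
  have d: "?d dvd (\<Sum>i<k. shiftp f (Suc i) * (?C (Suc i) * shiftp (?C b) 1 - ?C (Suc b) * shiftp (?C i) 1))"
    by (intro dvd_sum dvd_mult wr_poly_dvd_cofactor_minor nz b) simp
  show ?thesis unfolding eq by (rule dvd_add[OF d dvd_triv_left])
qed

lemma wr_poly_dvd_append_minor:
  assumes nz: "wr_poly g k \<noteq> 0"
  shows "shiftp (wr_poly g k) 1 dvd wr_append g k f * shiftp (wr_append g k f') 1
           - wr_append g k f' * shiftp (wr_append g k f) 1"
proof -
  let ?C = "wr_cofactor g k" and ?d = "shiftp (wr_poly g k) 1"
  obtain c where c: "wr_append g k f' = (\<Sum>i<k. shiftp f' (Suc i) * ?C (Suc i)) + ?d * c"
    by (rule wr_append_window)
  obtain c' where c': "shiftp (wr_append g k f') 1 = (\<Sum>i<k. shiftp f' (Suc i) * shiftp (?C i) 1) + ?d * c'"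
    by (rule shiftp_wr_append_window)
  have eq: "wr_append g k f * shiftp (wr_append g k f') 1 - wr_append g k f' * shiftp (wr_append g k f) 1
      = (\<Sum>i<k. shiftp f' (Suc i) * (wr_append g k f * shiftp (?C i) 1 - ?C (Suc i) * shiftp (wr_append g k f) 1))
        + ?d * (wr_append g k f * c' - c * shiftp (wr_append g k f) 1)"
    unfolding c' unfolding c by (simp add: algebra_simps sum_distrib_left sum_distrib_right sum_subtractf)
  have d: "?d dvd (\<Sum>i<k. shiftp f' (Suc i) *
      (wr_append g k f * shiftp (?C i) 1 - ?C (Suc i) * shiftp (wr_append g k f) 1))"
    by (intro dvd_sum dvd_mult wr_poly_dvd_append_cofactor nz) simp
  show ?thesis unfolding eq by (rule dvd_add[OF d dvd_triv_left])
qed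

section \<open>The polynomials \<open>Lhat\<close> and their derivatives at the origin\<close>

lemma Lhat_expand:
  "Lhat \<alpha> k \<beta> n = (\<Sum>i\<le>k. smult (poly (wr_cofactor (psi \<alpha> \<beta>) k i) (of_nat n))
                              (laguerre_int \<alpha> (int n - int i)))"
proof -
  let ?g = "psi \<alpha> \<beta>"
  define A where "A = mat (Suc k) (Suc k) (\<lambda>(i, j).
      if i < k then [: poly (?g i) (of_int (int n - int j)) :]
      else laguerre_int \<alpha> (int n - int j))"
  have "cofactor A k i = [: poly (wr_cofactor ?g k i) (of_nat n) :]" if "i \<le> k" for i
  proof -
    \<comment> \<open>Evaluation at \<open>n\<close>, read as a constant polynomial in
      \<open>x\<close>, is a ring homomorphism and so commutes with determinants.\<close>
    interpret comm_ring_hom "\<lambda>p :: complex poly. [: poly p (of_nat n) :]"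
      by (rule comm_ring_hom_poly_const)
    have "[: poly (wr_cofactor ?g k i) (of_nat n) :] = (-1) ^ (k + i) *
        [: poly (det (mat k k (\<lambda>(r, j). shiftp (?g r) (insert_index i j)))) (of_nat n) :]"
      unfolding wr_cofactor_eq[OF that] by (simp only: hom_mult hom_power hom_uminus hom_one)
    also have "\<dots> = (-1) ^ (k + i) *
        det (mat k k (\<lambda>(r, j). [: poly (?g r) (of_int (int n - int (insert_index i j))) :]))"
      unfolding hom_det[symmetric]
      by (intro arg_cong2[of _ _ _ _ "(*)"] refl arg_cong[of _ _ det] eq_matI) (auto simp: poly_shiftp)
    also have "\<dots> = cofactor A k i"
      by (rule cofactor_last_row[symmetric]) (use that in \<open>auto simp: A_def\<close>)
    finally show ?thesis ..
  qed
  moreover have "det A = (\<Sum>i<Suc k. A $$ (k, i) * cofactor A k i)"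
    by (rule laplace_expansion_row) (auto simp: A_def)
  moreover have "Lhat \<alpha> k \<beta> n = det A" by (simp only: Lhat_def A_def)
  ultimately show ?thesis unfolding lessThan_Suc_atMost by (simp add: A_def)
qed

lemma Lhat0_eq: "Lhat0 \<alpha> k \<beta> = wr_append (psi \<alpha> \<beta>) k (binpoly \<alpha>)"
  unfolding Lhat0_def wr_append_def by (rule wr_poly_expand)

lemma poly_wr_append_laguerre_deriv0:
  assumes "k \<le> n"
  shows "poly (wr_append (psi \<alpha> \<beta>) k (laguerre_deriv0 \<alpha> j)) (of_nat n)
           = poly ((pderiv ^^ j) (Lhat \<alpha> k \<beta> n)) 0"
proof -
  have "poly (shiftp (laguerre_deriv0 \<alpha> j) i) (of_nat n)
      = fact j * coeff (laguerre_int \<alpha> (int n - int i)) j" if "i \<le> k" for i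
    using poly_laguerre_deriv0[of \<alpha> j "n - i"] that assms
    by (simp add: poly_shiftp laguerre_int_def of_nat_diff nat_diff_distrib)
  then show ?thesis
    unfolding wr_append_def poly_0_higher_pderiv Lhat_expand
    by (simp add: poly_sum coeff_sum sum_distrib_left mult_ac)
qed

lemma tau_nonzero: "admissible \<alpha> k \<beta> \<Longrightarrow> tau \<alpha> k \<beta> \<noteq> 0"
  unfolding admissible_def by (metis poly_0 order.refl)

lemma coprime_tau_Lhat0:
  assumes "generic \<alpha> k \<beta>" and "1 \<le> k"
  shows "coprime (shiftp (tau \<alpha> k \<beta>) 1) (shiftp (Lhat0 \<alpha> k \<beta>) 1)"
    and "coprime (shiftp (tau \<alpha> k \<beta>) 1) (Lhat0 \<alpha> k \<beta>)"
proof -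
  let ?g = "psi \<alpha> \<beta>" and ?t = "tau \<alpha> k \<beta>" and ?a = "Lhat0 \<alpha> k \<beta>"
  have t: "?t \<noteq> 0"
    using assms(1) tau_nonzero unfolding generic_def by blast
  have roots: "poly ?t z = 0 \<Longrightarrow> poly ?a z \<noteq> 0" for z
    using resultant_nonzero_no_common_root[OF _ t] assms(1) unfolding generic_def by blast
  have t1: "shiftp ?t 1 \<noteq> 0" using t by (simp add: shiftp_eq_0_iff)
  show "coprime (shiftp ?t 1) (shiftp ?a 1)"
    by (rule coprime_if_no_common_root[OF t1]) (use roots in \<open>auto simp: poly_shiftp\<close>)
  show "coprime (shiftp ?t 1) ?a"
  proof (rule coprime_if_no_common_root[OF t1], rule notI)
    fix z assume z: "poly (shiftp ?t 1) z = 0" and a: "poly ?a z = 0"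
    \<comment> \<open>The index \<open>k - 1\<close> is chosen because its successor gives the last
      cofactor, which is \<open>tau\<close> itself.\<close>
    have "shiftp ?t 1 dvd ?a * shiftp (wr_cofactor ?g k (k - 1)) 1 - ?t * shiftp ?a 1"
      using wr_poly_dvd_append_cofactor[of ?g k "k - 1" "binpoly \<alpha>"] t assms(2)
      by (simp add: Lhat0_eq tau_def wr_cofactor_last)
    then have "poly (?a * shiftp (wr_cofactor ?g k (k - 1)) 1 - ?t * shiftp ?a 1) z = 0"
      using z by (elim dvdE) (simp only: poly_mult mult_zero_left)
    then have "poly ?t z * poly ?a (z - 1) = 0" using a by (simp add: poly_shiftp)
    moreover have "poly ?a (z - 1) \<noteq> 0" using z roots by (simp add: poly_shiftp)
    ultimately show False using roots a by auto
  qed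
qed

text \<open>Only the value of the eigenvalue equation at \<open>x = 0\<close> is used.\<close>
lemma Abar_subset_Aset:
  assumes gen: "generic \<alpha> k \<beta>" and k: "1 \<le> k" and h: "h \<in> Abar \<alpha> k \<beta>"
  shows "h \<in> Aset \<alpha> k \<beta>"
proof -
  let ?t = "tau \<alpha> k \<beta>" and ?a = "Lhat0 \<alpha> k \<beta>"
  define G where "G j = wr_append (psi \<alpha> \<beta>) k (laguerre_deriv0 \<alpha> j)" for j
  have G0: "G 0 = ?a" by (simp add: G_def Lhat0_eq)
  obtain B where B: "is_diffop B" "eigen \<alpha> k \<beta> B h" using h unfolding Abar_def by blast
  obtain m b where b: "B = (\<lambda>p x. \<Sum>j\<le>m. b j x * poly ((pderiv ^^ j) p) x)"
    using B(1) unfolding is_diffop_def by blast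
  \<comment> \<open>The coefficients \<open>b j\<close> are arbitrary functions of \<open>x\<close>,
    but at 0 they are constants independent of \<open>n\<close>. The eigenvalue equation becomes an
    identity of polynomials in \<open>n\<close>, usable at \<open>n - 1\<close> as well.\<close>
  have eq: "(\<Sum>j\<le>m. smult (b j 0) (G j)) = h * ?a"
  proof (rule poly_eqI_of_nat[of k])
    fix n assume n: "n \<ge> k"
    have "B (Lhat \<alpha> k \<beta> n) 0 = poly h (of_nat n) * poly (Lhat \<alpha> k \<beta> n) 0"
      using B(2) unfolding eigen_def by metis
    moreover have "poly (G j) (of_nat n) = poly ((pderiv ^^ j) (Lhat \<alpha> k \<beta> n)) 0" for j
      unfolding G_def by (rule poly_wr_append_laguerre_deriv0[OF n])
    ultimately show "poly (\<Sum>j\<le>m. smult (b j 0) (G j)) (of_nat n) = poly (h * ?a) (of_nat n)"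
      by (simp add: G0[symmetric] poly_sum b)
  qed
  have t: "wr_poly (psi \<alpha> \<beta>) k \<noteq> 0"
    using gen tau_nonzero unfolding generic_def tau_def by blast
  have "shiftp ?t 1 dvd (\<Sum>j\<le>m. smult (b j 0) (?a * shiftp (G j) 1 - G j * shiftp ?a 1))"
    unfolding tau_def Lhat0_eq G_def by (intro dvd_sum dvd_smult wr_poly_dvd_append_minor t)
  also have "(\<Sum>j\<le>m. smult (b j 0) (?a * shiftp (G j) 1 - G j * shiftp ?a 1))
      = ?a * shiftp (\<Sum>j\<le>m. smult (b j 0) (G j)) 1 - (\<Sum>j\<le>m. smult (b j 0) (G j)) * shiftp ?a 1"
    by (simp add: shiftp_sum sum_distrib_left sum_distrib_right sum_subtractf smult_diff_right
        shiftp_smult)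
  also have "\<dots> = (?a * shiftp ?a 1) * (shiftp h 1 - h)"
    unfolding eq by (simp add: shiftp_mult algebra_simps)
  finally have "shiftp ?t 1 dvd shiftp h 1 - h"
    using coprime_tau_Lhat0[OF gen k] by (simp add: coprime_dvd_mult_right_iff)
  then have "shiftp ?t 1 dvd - (shiftp h 1 - h)" by (simp only: dvd_minus_iff)
  then show ?thesis by (simp add: Aset_def)
qed

section \<open>Degrees, eigenoperators and the equality of the sets\<close>

lemma degree_Lhat:
  assumes "admissible \<alpha> k \<beta>"
  shows "degree (Lhat \<alpha> k \<beta> n) = n" and "Lhat \<alpha> k \<beta> n \<noteq> 0"
proof -
  let ?C = "\<lambda>i. poly (wr_cofactor (psi \<alpha> \<beta>) k i) (of_nat n)"
  have zero: "coeff (laguerre_int \<alpha> (int n - int i)) m = 0" if "m > n \<or> m = n \<and> i > 0" for i m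
    using that by (auto simp: laguerre_int_def coeff_laguerre intro!: binomial_eq_0)
  \<comment> \<open>Only the summand \<open>i = 0\<close> reaches degree \<open>n\<close>; its
    factor is \<open>tau\<close> at \<open>n - 1\<close>, which for \<open>n = 0\<close> is the
    value at -1.\<close>
  have "poly (tau \<alpha> k \<beta>) (of_int (int n - 1)) \<noteq> 0"
    using assms unfolding admissible_def by (elim allE[of _ "int n - 1"]) simp
  then have C0: "?C 0 \<noteq> 0" by (simp add: wr_cofactor_0 poly_shiftp tau_def)
  have "coeff (Lhat \<alpha> k \<beta> n) n = (\<Sum>i\<le>k. if i = 0 then ?C 0 * coeff (laguerre \<alpha> n) n else 0)"
    unfolding Lhat_expand coeff_sum coeff_smult
    by (intro sum.cong refl) (auto simp: zero, simp add: laguerre_int_def)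
  then have nz: "coeff (Lhat \<alpha> k \<beta> n) n \<noteq> 0"
    using C0 by (simp add: coeff_laguerre add.commute)
  moreover have "coeff (Lhat \<alpha> k \<beta> n) m = 0" if "m > n" for m
    using that by (simp add: Lhat_expand coeff_sum zero)
  ultimately show "degree (Lhat \<alpha> k \<beta> n) = n"
    by (intro antisym degree_le le_degree) auto
  show "Lhat \<alpha> k \<beta> n \<noteq> 0" using nz by auto
qed

lemma Aset_Dalg_eigen:
  assumes "h \<in> Aset \<alpha> k \<beta>"
  obtains B where "B \<in> Dalg_ops" "is_diffop B" "eigen \<alpha> k \<beta> B h"
proof -
  obtain T where T: "T \<in> Dalg" "\<And>n. T (Lhat \<alpha> k \<beta> n) = smult (poly h (of_nat n)) (Lhat \<alpha> k \<beta> n)"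
    using Dalg_eigen_operator[of "psi \<alpha> \<beta>" k h \<alpha>] assms
    unfolding Aset_def tau_def Lhat_expand mem_Collect_eq by blast
  have "(\<lambda>p. poly (T p)) \<in> Dalg_ops" using T(1) unfolding Dalg_ops_def by blast
  moreover have "eigen \<alpha> k \<beta> (\<lambda>p. poly (T p)) h" by (simp add: eigen_def T(2) fun_eq_iff)
  ultimately show thesis using that Dalg_ops_diffop by blast
qed

theorem theorem5p3:
  fixes \<alpha> k :: nat and \<beta> :: "nat \<Rightarrow> complex"
  assumes "1 \<le> \<alpha>" and "1 \<le> k" and "k \<le> \<alpha>"
    and "generic \<alpha> k \<beta>"
  shows "Aset \<alpha> k \<beta> = Abar \<alpha> k \<beta> \<and> Dset \<alpha> k \<beta> = Dbar \<alpha> k \<beta>"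
proof
  show A: "Aset \<alpha> k \<beta> = Abar \<alpha> k \<beta>"
  proof
    show "Aset \<alpha> k \<beta> \<subseteq> Abar \<alpha> k \<beta>"
      unfolding Abar_def using Aset_Dalg_eigen by blast
    show "Abar \<alpha> k \<beta> \<subseteq> Aset \<alpha> k \<beta>"
      using Abar_subset_Aset[OF assms(4,2)] by blast
  qed
  show "Dset \<alpha> k \<beta> = Dbar \<alpha> k \<beta>"
  proof
    show "Dset \<alpha> k \<beta> \<subseteq> Dbar \<alpha> k \<beta>"
      unfolding Dset_def Dbar_def A using Dalg_ops_diffop by blast
    show "Dbar \<alpha> k \<beta> \<subseteq> Dset \<alpha> k \<beta>"
    proof
      fix B assume "B \<in> Dbar \<alpha> k \<beta>"
      then obtain h where B: "is_diffop B" and h: "h \<in> Aset \<alpha> k \<beta>" "eigen \<alpha> k \<beta> B h"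
        unfolding Dbar_def A by blast
      obtain B' where B': "B' \<in> Dalg_ops" "is_diffop B'" "eigen \<alpha> k \<beta> B' h"
        using Aset_Dalg_eigen[OF h(1)] .
      have adm: "admissible \<alpha> k \<beta>" using assms(4) unfolding generic_def by blast
      have "B = B'"
        using h(2) B'(3) unfolding eigen_def
        by (intro diffop_eqI[OF B B'(2) degree_Lhat(1)[OF adm] degree_Lhat(2)[OF adm]]) simp
      then show "B \<in> Dset \<alpha> k \<beta>" using B' h unfolding Dset_def by blast
    qed
  qed
qed

end
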